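(* Let $G$ be a finite group and let $S\subseteq G\setminus\{1\}$ satisfy $S=S^{-1}$, $S\neq G\setminus\{1\}$ and $S\neq\emptyset$. Then $\mathrm{Cay}(G,S)$ has a non-trivial homogeneous set if and only if there exists a subgroup $H$ of $G$ with $H\neq\{1\}$ and $H\neq G$ such that for every $c\in S\setminus H$ the right coset $Hc$ is contained in $S$. Furthermore, if $\mathrm{Cay}(G,S)$ is both connected and anti-connected and has a non-trivial homogeneous set, then one may choose $H$ to be the maximal homogeneous set containing $1$: that is, if $H$ is an inclusion-maximal element among the non-trivial homogeneous sets of $\mathrm{Cay}(G,S)$ containing $1$, then $H$ is a subgroup of $G$ and $Hc\subseteq S$ for every $c\in S\setminus H$.
   Context: All graphs are undirected, simple and finite. $\mathrm{Cay}(G,S)$ is the graph with vertex set $G$ in which $x$ and $y$ are adjacent iff $x^{-1}y\in S$. A non-empty set $H$ of vertices of a graph $\Gamma$ is homogeneous if every vertex $x\notin H$ is adjacent either to all elements of $H$ or to none; it is non-trivial if $2\le|H|<|V(\Gamma)|$. A graph is anti-connected if its complement is connected. *)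

theory Defs
  imports "Graph_Theory.Graph_Theory" "HOL-Algebra.Coset"
begin

text \<open>An undirected simple graph is a \<open>pair_graph\<close> of Graph_Theory: a finite, loop-free digraph
  without parallel arcs whose arc relation is symmetric.\<close>

definition Cay :: "('a, 'b) monoid_scheme \<Rightarrow> 'a set \<Rightarrow> 'a pair_pre_digraph" where
  "Cay G S = \<lparr> pverts = carrier G,
     parcs = {(x, y). x \<in> carrier G \<and> y \<in> carrier G \<and> inv\<^bsub>G\<^esub> x \<otimes>\<^bsub>G\<^esub> y \<in> S} \<rparr>"

lemma (in group) pair_graph_Cay:
  assumes fin: "finite (carrier G)" and S: "S \<subseteq> carrier G - {\<one>}" and Sinv: "S = set_inv S"
  shows "pair_graph (Cay G S)"
proof
  fix e
  assume e: "e \<in> parcs (Cay G S)"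
  show "fst e \<in> pverts (Cay G S)" "snd e \<in> pverts (Cay G S)"
    using e by (auto simp: Cay_def)
  show "fst e \<noteq> snd e"
    using e S by (auto simp: Cay_def)
next
  show "finite (pverts (Cay G S))"
    using fin by (simp add: Cay_def)
  have "parcs (Cay G S) \<subseteq> carrier G \<times> carrier G"
    by (auto simp: Cay_def)
  then show "finite (parcs (Cay G S))"
    by (rule finite_subset) (use fin in simp)
  have "inv y \<otimes> x \<in> S" if "x \<in> carrier G" "y \<in> carrier G" "inv x \<otimes> y \<in> S" for x y
  proof -
    have "inv (inv x \<otimes> y) \<in> set_inv S"
      using that by (auto simp: SET_INV_def)
    then show ?thesis
      using that Sinv by (simp add: inv_mult_group)
  qed
  then show "symmetric (with_proj (Cay G S))"
    by (auto simp: symmetric_def sym_def Cay_def)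
qed

definition graph_compl :: "'a pair_pre_digraph \<Rightarrow> 'a pair_pre_digraph" where
  "graph_compl \<Gamma> = \<lparr> pverts = pverts \<Gamma>,
     parcs = {(x, y). x \<in> pverts \<Gamma> \<and> y \<in> pverts \<Gamma> \<and> x \<noteq> y \<and> (x, y) \<notin> parcs \<Gamma>} \<rparr>"

definition connected_graph :: "'a pair_pre_digraph \<Rightarrow> bool" where
  "connected_graph \<Gamma> \<longleftrightarrow> Digraph_Component.connected (with_proj \<Gamma>)"

definition anti_connected :: "'a pair_pre_digraph \<Rightarrow> bool" where
  "anti_connected \<Gamma> \<longleftrightarrow> connected_graph (graph_compl \<Gamma>)"

definition homogeneous :: "'a pair_pre_digraph \<Rightarrow> 'a set \<Rightarrow> bool" where
  "homogeneous \<Gamma> H \<longleftrightarrow> H \<noteq> {} \<and> H \<subseteq> pverts \<Gamma> \<and>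
     (\<forall>x \<in> pverts \<Gamma> - H. (\<forall>h\<in>H. (x, h) \<in> parcs \<Gamma>) \<or> (\<forall>h\<in>H. (x, h) \<notin> parcs \<Gamma>))"

definition nontrivial_homogeneous :: "'a pair_pre_digraph \<Rightarrow> 'a set \<Rightarrow> bool" where
  "nontrivial_homogeneous \<Gamma> H \<longleftrightarrow>
     homogeneous \<Gamma> H \<and> 2 \<le> card H \<and> card H < card (pverts \<Gamma>)"

definition maximal_homogeneous_at :: "'a pair_pre_digraph \<Rightarrow> 'a \<Rightarrow> 'a set \<Rightarrow> bool" where
  "maximal_homogeneous_at \<Gamma> v H \<longleftrightarrow> nontrivial_homogeneous \<Gamma> H \<and> v \<in> H \<and>
     (\<forall>K. nontrivial_homogeneous \<Gamma> K \<and> v \<in> K \<and> H \<subseteq> K \<longrightarrow> K = H)"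

end

theory Submission
  imports Defs "HOL-Algebra.Generated_Groups"
begin

text \<open>
  If \<open>A\<close> and \<open>B\<close> are overlapping homogeneous sets, then so is \<open>A \<union> B\<close>; if moreover \<open>A \<union> B\<close> is the
  whole vertex set and neither contains the other, then \<open>A - B\<close> is complete or anticomplete to \<open>B\<close>.
  In a graph that is both connected and anti-connected, non-trivial homogeneous sets through a
  common vertex are therefore closed under union, so a maximal one \<open>H\<close> containing \<open>\<one>\<close> absorbs all
  its translates \<open>inv h <# H\<close> with \<open>h \<in> H\<close>; this says that \<open>H\<close> is a subgroup.  If the Cayley graph
  or its complement, which is the Cayley graph of \<open>carrier G - {\<one>} - S\<close>, is disconnected, then its
  connection set generates a proper subgroup with the required property.
\<close>

section \<open>Homogeneous sets in arbitrary graphs\<close>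

lemma homogeneous_Un:
  assumes "homogeneous \<Gamma> A" "homogeneous \<Gamma> B" "A \<inter> B \<noteq> {}"
  shows "homogeneous \<Gamma> (A \<union> B)"
proof -
  obtain z where z: "z \<in> A" "z \<in> B"
    using assms(3) by blast
  have "(\<forall>h\<in>A \<union> B. (x, h) \<in> parcs \<Gamma>) \<or> (\<forall>h\<in>A \<union> B. (x, h) \<notin> parcs \<Gamma>)"
    if "x \<in> pverts \<Gamma> - (A \<union> B)" for x
  \<comment> \<open>The common element \<open>z\<close> decides: its adjacency to \<open>x\<close>
    fixes that of all of \<open>A\<close> and all of \<open>B\<close>.\<close>
  proof (cases "(x, z) \<in> parcs \<Gamma>")
    case True
    then show ?thesis using that assms z unfolding homogeneous_def by blast
  next
    case False
    then show ?thesis using that assms z unfolding homogeneous_def by blast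
  qed
  then show ?thesis
    using assms unfolding homogeneous_def by blast
qed

text \<open>Fix \<open>y\<close> in \<open>B - A\<close>. Each \<open>x\<close> in
  \<open>A - B\<close> treats all of \<open>B\<close> as it treats \<open>y\<close>, and
  \<open>y\<close>, lying outside \<open>A\<close>, treats all of \<open>A\<close> alike; hence all
  pairs between \<open>A - B\<close> and \<open>B\<close> have the same status.\<close>

lemma homogeneous_cover:
  assumes sym: "sym (parcs \<Gamma>)"
    and A: "homogeneous \<Gamma> A" and B: "homogeneous \<Gamma> B"
    and cover: "A \<union> B = pverts \<Gamma>" and ne: "B - A \<noteq> {}"
  shows "(A - B) \<times> B \<subseteq> parcs \<Gamma> \<or> (A - B) \<times> B \<inter> parcs \<Gamma> = {}"
proof -
  obtain y where y: "y \<in> B" "y \<notin> A"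
    using ne by blast
  have unifA: "(y, a) \<in> parcs \<Gamma> \<longleftrightarrow> (y, a') \<in> parcs \<Gamma>" if "a \<in> A" "a' \<in> A" for a a'
    using that A y cover unfolding homogeneous_def by blast
  have unifB: "(x, b) \<in> parcs \<Gamma> \<longleftrightarrow> (x, b') \<in> parcs \<Gamma>" if "x \<in> A - B" "b \<in> B" "b' \<in> B" for x b b'
    using that B cover unfolding homogeneous_def by blast
  have "(x, b) \<in> parcs \<Gamma> \<longleftrightarrow> (x', b') \<in> parcs \<Gamma>"
    if "x \<in> A - B" "x' \<in> A - B" "b \<in> B" "b' \<in> B" for x x' b b'
  proof -
    have "(x, b) \<in> parcs \<Gamma> \<longleftrightarrow> (y, x) \<in> parcs \<Gamma>"
      using unifB[OF that(1,3) y(1)] sym by (auto dest: symD)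
    also have "\<dots> \<longleftrightarrow> (y, x') \<in> parcs \<Gamma>"
      using unifA that by blast
    also have "\<dots> \<longleftrightarrow> (x', b') \<in> parcs \<Gamma>"
      using unifB[OF that(2,4) y(1)] sym by (auto dest: symD)
    finally show ?thesis .
  qed
  then show ?thesis by blast
qed

lemma nontrivial_homogeneous_extend_maximal:
  assumes fin: "finite (pverts \<Gamma>)" and X: "nontrivial_homogeneous \<Gamma> X" "v \<in> X"
  shows "\<exists>H. maximal_homogeneous_at \<Gamma> v H"
proof -
  let ?F = "{K. nontrivial_homogeneous \<Gamma> K \<and> v \<in> K}"
  have "?F \<subseteq> Pow (pverts \<Gamma>)"
    by (auto simp: nontrivial_homogeneous_def homogeneous_def)
  then have "finite ?F"
    using fin by (simp add: finite_subset)
  moreover have "?F \<noteq> {}"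
    using X by blast
  ultimately obtain H where "H \<in> ?F" "\<forall>K\<in>?F. H \<le> K \<longrightarrow> H = K"
    using finite_has_maximal by blast
  then show ?thesis
    unfolding maximal_homogeneous_at_def by blast
qed

section \<open>Complement and symmetry of Cayley graphs\<close>

lemma pverts_Cay [simp]: "pverts (Cay G S) = carrier G"
  by (simp add: Cay_def)

lemma parcs_Cay_iff:
  "(x, y) \<in> parcs (Cay G S) \<longleftrightarrow> x \<in> carrier G \<and> y \<in> carrier G \<and> inv\<^bsub>G\<^esub> x \<otimes>\<^bsub>G\<^esub> y \<in> S"
  by (simp add: Cay_def)

context group
begin

lemma graph_compl_Cay: "graph_compl (Cay G S) = Cay G (carrier G - {\<one>} - S)"
proof -
  have "x \<noteq> y \<longleftrightarrow> inv x \<otimes> y \<noteq> \<one>" if "x \<in> carrier G" "y \<in> carrier G" for x y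
    using that by (metis inv_closed inv_equality inv_inv l_inv)
  then show ?thesis
    by (auto simp: graph_compl_def Cay_def)
qed

lemma inv_mem_of_set_inv:
  assumes "S = set_inv S" "s \<in> S"
  shows "inv s \<in> S"
  using assms by (auto simp: SET_INV_def)

text \<open>Allows results on inverse-closed connection sets to be applied to the complement graph
  as well.\<close>

lemma set_inv_compl:
  assumes "S \<subseteq> carrier G" "S = set_inv S"
  shows "carrier G - {\<one>} - S = set_inv (carrier G - {\<one>} - S)"
proof -
  have *: "inv t \<in> carrier G - {\<one>} - S" if "t \<in> carrier G - {\<one>} - S" for t
    using that inv_mem_of_set_inv[OF assms(2)] by (metis Diff_iff inv_closed inv_eq_1_iff inv_inv singleton_iff)
  show ?thesis
  proof
    show "set_inv (carrier G - {\<one>} - S) \<subseteq> carrier G - {\<one>} - S"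
      using * by (auto simp: SET_INV_def simp del: Diff_iff)
    show "carrier G - {\<one>} - S \<subseteq> set_inv (carrier G - {\<one>} - S)"
    proof
      fix t
      assume t: "t \<in> carrier G - {\<one>} - S"
      then have "t = inv (inv t)" by simp
      then show "t \<in> set_inv (carrier G - {\<one>} - S)"
        unfolding SET_INV_def using *[OF t] by blast
    qed
  qed
qed

lemma sym_Cay:
  assumes "S = set_inv S"
  shows "sym (parcs (Cay G S))"
proof (rule symI)
  fix x y
  assume "(x, y) \<in> parcs (Cay G S)"
  then have xy: "x \<in> carrier G" "y \<in> carrier G" "inv x \<otimes> y \<in> S"
    by (auto simp: parcs_Cay_iff)
  then have "inv (inv x \<otimes> y) \<in> S"
    using inv_mem_of_set_inv[OF assms] by blast
  then show "(y, x) \<in> parcs (Cay G S)"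
    using xy by (simp add: parcs_Cay_iff inv_mult_group)
qed

section \<open>Connectedness and generation\<close>

lemma connected_Cay_imp_generate:
  assumes S: "S \<subseteq> carrier G" and conn: "connected_graph (Cay G S)"
  shows "generate G S = carrier G"
proof
  show "generate G S \<subseteq> carrier G"
    using S by (rule generate_incl)
  show "carrier G \<subseteq> generate G S"
  proof
    fix g
    assume "g \<in> carrier G"
    then have "\<one> \<rightarrow>\<^sup>*\<^bsub>with_proj (mk_symmetric (with_proj (Cay G S)))\<^esub> g"
      using conn by (simp add: connected_graph_def Digraph_Component.connected_def strongly_connected_def)
    then show "g \<in> generate G S"
      unfolding reachable_def
    proof (induction rule: rtrancl_on_induct)
      case base
      show ?case by (rule generate.one)
    next
      case (step x y)
      \<comment> \<open>Connectedness of a digraph means reachability in its symmetric closure, so a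
        step may reverse an arc; it then contributes the inverse of a generator.\<close>
      have xy: "x \<in> carrier G" "y \<in> carrier G" and "inv x \<otimes> y \<in> S \<or> inv y \<otimes> x \<in> S"
        using step.hyps by (auto simp: parcs_mk_symmetric parcs_Cay_iff)
      then have "inv x \<otimes> y \<in> generate G S"
      proof (elim disjE)
        assume "inv y \<otimes> x \<in> S"
        then have "inv (inv y \<otimes> x) \<in> generate G S"
          by (rule generate.inv)
        then show ?thesis
          using xy by (simp add: inv_mult_group)
      qed (rule generate.incl)
      then have "x \<otimes> (inv x \<otimes> y) \<in> generate G S"
        using step.IH by (rule generate.eng[rotated])
      then show ?case
        using xy by (simp add: m_assoc[symmetric])
    qed
  qed
qed

text \<open>Right multiplication by an element of \<open>S\<close> follows an arc, and no arc leaves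
  \<open>A\<close>. So \<open>A\<close> is stable under right multiplication by \<open>S\<close>,
  hence by everything that \<open>S\<close> generates, and any \<open>g\<close> is reached from
  \<open>a\<close> in \<open>A\<close> as \<open>a \<otimes> (inv a \<otimes> g)\<close>.\<close>

lemma generate_closed_imp_carrier:
  assumes S: "S \<subseteq> carrier G" "S = set_inv S" and gen: "generate G S = carrier G"
    and A: "A \<subseteq> carrier G" "A \<noteq> {}"
    and closed: "\<And>x y. x \<in> A \<Longrightarrow> y \<in> carrier G - A \<Longrightarrow> inv x \<otimes> y \<notin> S"
  shows "A = carrier G"
proof -
  have step: "a \<otimes> s \<in> A" if "a \<in> A" "s \<in> S" for a s
  proof (rule ccontr)
    assume "a \<otimes> s \<notin> A"
    moreover have "a \<in> carrier G" "s \<in> carrier G"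
      using that A S by auto
    ultimately show False
      using closed[of a "a \<otimes> s"] that by (simp add: m_assoc[symmetric])
  qed
  have *: "\<forall>a\<in>A. a \<otimes> g \<in> A" if "g \<in> generate G S" for g
    using that
  proof (induction rule: generate.induct)
    case one
    then show ?case using A by auto
  next
    case (incl h)
    then show ?case using step by blast
  next
    case (inv h)
    then show ?case using step inv_mem_of_set_inv[OF S(2)] by blast
  next
    case (eng h1 h2)
    then have "h1 \<in> carrier G" "h2 \<in> carrier G"
      using gen by auto
    then show ?case
      using eng.IH A by (simp add: m_assoc[symmetric] subset_iff)
  qed
  obtain a where a: "a \<in> A" "a \<in> carrier G"
    using A by blast
  have "g \<in> A" if "g \<in> carrier G" for g
  proof -
    have "a \<otimes> (inv a \<otimes> g) \<in> A"
      using * a that gen by simp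
    then show ?thesis
      using a that by (simp add: m_assoc[symmetric])
  qed
  then show ?thesis
    using A by blast
qed

section \<open>Translates and unions of homogeneous sets in Cayley graphs\<close>

lemma nontrivial_homogeneous_l_coset:
  assumes X: "nontrivial_homogeneous (Cay G S) X" and g: "g \<in> carrier G"
  shows "nontrivial_homogeneous (Cay G S) (g <# X)"
proof -
  have sub: "X \<subseteq> carrier G" and hom: "homogeneous (Cay G S) X"
    using X by (auto simp: nontrivial_homogeneous_def homogeneous_def)
  have img: "g <# X = (\<lambda>x. g \<otimes> x) ` X"
    by (auto simp: l_coset_def)
  have "inj_on (\<lambda>x. g \<otimes> x) X"
    by (rule inj_onI) (use sub g in \<open>simp add: subset_iff\<close>)
  then have card: "card (g <# X) = card X"
    unfolding img by (rule card_image)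
  \<comment> \<open>Left translation is a graph automorphism, because
    \<open>inv x \<otimes> (g \<otimes> h)\<close> equals
    \<open>inv (inv g \<otimes> x) \<otimes> h\<close>.\<close>
  have adj: "(x, g \<otimes> h) \<in> parcs (Cay G S) \<longleftrightarrow> (inv g \<otimes> x, h) \<in> parcs (Cay G S)"
    if "x \<in> carrier G" "h \<in> X" for x h
    using that sub g by (auto simp: parcs_Cay_iff inv_mult_group m_assoc)
  have "homogeneous (Cay G S) (g <# X)"
    unfolding homogeneous_def
  proof (intro conjI ballI)
    show "g <# X \<noteq> {}"
      using hom by (auto simp: img homogeneous_def)
    show "g <# X \<subseteq> pverts (Cay G S)"
      using g sub by (auto simp: img)
  next
    fix x
    assume "x \<in> pverts (Cay G S) - (g <# X)"
    then have x: "x \<in> carrier G" "x \<notin> g <# X" by auto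
    have "inv g \<otimes> x \<notin> X"
    proof
      assume "inv g \<otimes> x \<in> X"
      then have "g \<otimes> (inv g \<otimes> x) \<in> g <# X"
        unfolding img by blast
      then show False
        using x g by (simp add: m_assoc[symmetric])
    qed
    then have "(\<forall>h\<in>X. (inv g \<otimes> x, h) \<in> parcs (Cay G S)) \<or> (\<forall>h\<in>X. (inv g \<otimes> x, h) \<notin> parcs (Cay G S))"
      using hom x g unfolding homogeneous_def by simp
    then show "(\<forall>h\<in>g <# X. (x, h) \<in> parcs (Cay G S)) \<or> (\<forall>h\<in>g <# X. (x, h) \<notin> parcs (Cay G S))"
      unfolding img using adj x by auto
  qed
  then show ?thesis
    using X card by (simp add: nontrivial_homogeneous_def)
qed

text \<open>By vertex-transitivity \<open>X\<close> can be translated by the inverse of one of its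
  elements.\<close>

lemma nontrivial_homogeneous_through_one:
  assumes X: "nontrivial_homogeneous (Cay G S) X"
  obtains Y where "nontrivial_homogeneous (Cay G S) Y" "\<one> \<in> Y"
proof -
  obtain x where x: "x \<in> X" "x \<in> carrier G"
    using X by (auto simp: nontrivial_homogeneous_def homogeneous_def)
  have "inv x \<otimes> x \<in> inv x <# X"
    using x(1) unfolding l_coset_def by blast
  then show thesis
    using that nontrivial_homogeneous_l_coset[OF X, of "inv x"] x by auto
qed

text \<open>The two generation hypotheses stand for connectedness and anti-connectedness. Only
  properness of the union is at stake: if it were everything, \<open>homogeneous_cover\<close> would
  cut off \<open>B\<close> from its complement either in the graph or in the complement
  graph.\<close>

lemma nontrivial_homogeneous_Un:
  assumes fin: "finite (carrier G)"
    and S: "S \<subseteq> carrier G" "S = set_inv S"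
    and gen: "generate G S = carrier G" "generate G (carrier G - {\<one>} - S) = carrier G"
    and A: "nontrivial_homogeneous (Cay G S) A" and B: "nontrivial_homogeneous (Cay G S) B"
    and meet: "A \<inter> B \<noteq> {}"
  shows "nontrivial_homogeneous (Cay G S) (A \<union> B)"
proof -
  let ?T = "carrier G - {\<one>} - S"
  have hom: "homogeneous (Cay G S) A" "homogeneous (Cay G S) B"
    and proper: "A \<noteq> carrier G" "B \<noteq> carrier G"
    and sub: "A \<subseteq> carrier G" "B \<subseteq> carrier G"
    using A B by (auto simp: nontrivial_homogeneous_def homogeneous_def)
  have "A \<union> B \<noteq> carrier G"
  proof
    assume cover: "A \<union> B = carrier G"
    have D: "B \<subseteq> carrier G" "B \<noteq> {}"
      using sub meet by auto
    have compl: "carrier G - B = A - B"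
      using cover by blast
    have "B - A \<noteq> {}"
      using proper cover by blast
    then consider "(A - B) \<times> B \<subseteq> parcs (Cay G S)" | "(A - B) \<times> B \<inter> parcs (Cay G S) = {}"
      using homogeneous_cover[OF sym_Cay[OF S(2)] hom] cover by auto
    then show False
    proof cases
      case 1
      \<comment> \<open>\<open>B\<close> is completely joined to its complement, so no arc of the
        complement graph leaves \<open>B\<close>.\<close>
      have "inv x \<otimes> y \<notin> ?T" if "x \<in> B" "y \<in> carrier G - B" for x y
      proof -
        have "(x, y) \<in> parcs (Cay G S)"
          using 1 that compl sym_Cay[OF S(2)] by (blast dest: symD)
        then show ?thesis by (simp add: parcs_Cay_iff)
      qed
      then have "B = carrier G"
        using generate_closed_imp_carrier[OF _ set_inv_compl[OF S] gen(2) D] by blast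
      then show False using proper by blast
    next
      case 2
      have "inv x \<otimes> y \<notin> S" if "x \<in> B" "y \<in> carrier G - B" for x y
      proof -
        have "(x, y) \<notin> parcs (Cay G S)"
          using 2 that compl sym_Cay[OF S(2)] by (blast dest: symD)
        then show ?thesis using that D by (auto simp: parcs_Cay_iff)
      qed
      then have "B = carrier G"
        using generate_closed_imp_carrier[OF S gen(1) D] by blast
      then show False using proper by blast
    qed
  qed
  then have "card (A \<union> B) < card (carrier G)"
    using sub fin by (intro psubset_card_mono) auto
  moreover have "card A \<le> card (A \<union> B)"
    using sub fin by (intro card_mono) (auto intro: finite_subset)
  ultimately show ?thesis
    using A homogeneous_Un[OF hom meet] by (simp add: nontrivial_homogeneous_def)
qed

section \<open>Homogeneous sets and subgroups\<close>

lemma maximal_homogeneous_subgroup: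
  assumes fin: "finite (carrier G)"
    and S: "S \<subseteq> carrier G" "S = set_inv S"
    and gen: "generate G S = carrier G" "generate G (carrier G - {\<one>} - S) = carrier G"
    and H: "maximal_homogeneous_at (Cay G S) \<one> H"
  shows "subgroup H G"
proof -
  have nh: "nontrivial_homogeneous (Cay G S) H" and one: "\<one> \<in> H"
    and max: "\<And>K. nontrivial_homogeneous (Cay G S) K \<Longrightarrow> \<one> \<in> K \<Longrightarrow> H \<subseteq> K \<Longrightarrow> K = H"
    using H by (auto simp: maximal_homogeneous_at_def)
  have sub: "H \<subseteq> carrier G"
    using nh by (auto simp: nontrivial_homogeneous_def homogeneous_def)
  have quot: "inv h \<otimes> k \<in> H" if "h \<in> H" "k \<in> H" for h k
  proof -
    have h: "h \<in> carrier G"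
      using that sub by blast
    have mem: "inv h \<otimes> l \<in> inv h <# H" if "l \<in> H" for l
      using that by (auto simp: l_coset_def)
    \<comment> \<open>The translate meets \<open>H\<close> in \<open>\<one>\<close>, so their union
      is again non-trivial homogeneous, and maximality forces the translate into
      \<open>H\<close>.\<close>
    have "\<one> \<in> inv h <# H"
      using mem[OF \<open>h \<in> H\<close>] h by simp
    then have "nontrivial_homogeneous (Cay G S) (H \<union> (inv h <# H))"
      using one h by (intro nontrivial_homogeneous_Un[OF fin S gen nh]
          nontrivial_homogeneous_l_coset[OF nh]) auto
    then have "H \<union> (inv h <# H) = H"
      using one by (intro max) auto
    then show ?thesis
      using mem[OF \<open>k \<in> H\<close>] by blast
  qed
  have inv: "inv h \<in> H" if "h \<in> H" for h
    using quot[OF that one] that sub by (simp add: subset_iff)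
  show ?thesis
  proof (rule subgroupI)
    show "h \<otimes> k \<in> H" if "h \<in> H" "k \<in> H" for h k
      using quot[OF inv[OF that(1)] that(2)] that sub by (simp add: subset_iff)
  qed (use sub one inv in auto)
qed

text \<open>The outside vertex \<open>c\<close> is adjacent to \<open>\<one>\<close>, hence by
  homogeneity to \<open>inv h\<close> for each \<open>h\<close> in \<open>H\<close>; read from
  \<open>inv h\<close>, this adjacency says that \<open>h \<otimes> c\<close> is in
  \<open>S\<close>.\<close>

lemma homogeneous_subgroup_r_coset_subset:
  assumes S: "S \<subseteq> carrier G" "S = set_inv S"
    and H: "homogeneous (Cay G S) H" "subgroup H G" and c: "c \<in> S - H"
  shows "H #> c \<subseteq> S"
proof
  interpret H: subgroup H G by fact
  fix z
  assume "z \<in> H #> c"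
  then obtain h where h: "h \<in> H" "z = h \<otimes> c"
    by (auto simp: r_coset_def)
  have cG: "c \<in> carrier G" "c \<notin> H"
    using c S by auto
  have "(c, \<one>) \<in> parcs (Cay G S)"
    using c cG inv_mem_of_set_inv[OF S(2)] by (simp add: parcs_Cay_iff)
  then have "(c, inv h) \<in> parcs (Cay G S)"
    using H(1) cG h(1) H.one_closed H.m_inv_closed unfolding homogeneous_def by fastforce
  then have "(inv h, c) \<in> parcs (Cay G S)"
    using sym_Cay[OF S(2)] by (blast dest: symD)
  then show "z \<in> S"
    using h by (simp add: parcs_Cay_iff)
qed

text \<open>One neighbour \<open>h\<close> in \<open>H\<close> of an outside vertex \<open>x\<close>
  forces all: \<open>inv h \<otimes> x\<close> lies in \<open>S - H\<close>, and for
  \<open>k\<close> in \<open>H\<close> the element \<open>inv k \<otimes> x\<close> lies in its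
  right coset, hence in \<open>S\<close>.\<close>

lemma subgroup_nontrivial_homogeneous:
  assumes fin: "finite (carrier G)"
    and S: "S = set_inv S"
    and H: "subgroup H G" "H \<noteq> {\<one>}" "H \<noteq> carrier G"
    and coset: "\<And>c. c \<in> S - H \<Longrightarrow> H #> c \<subseteq> S"
  shows "nontrivial_homogeneous (Cay G S) H"
proof -
  interpret H: subgroup H G by fact
  have "(x, k) \<in> parcs (Cay G S)"
    if x: "x \<in> carrier G - H" and h: "h \<in> H" "(x, h) \<in> parcs (Cay G S)" and k: "k \<in> H" for x h k
  proof -
    have car: "x \<in> carrier G" "h \<in> carrier G" "k \<in> carrier G"
      using x h k by auto
    have "inv h \<otimes> x \<notin> H"
    proof
      assume "inv h \<otimes> x \<in> H"
      then have "h \<otimes> (inv h \<otimes> x) \<in> H"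
        using h by blast
      then show False
        using x car by (simp add: m_assoc[symmetric])
    qed
    moreover have "inv h \<otimes> x \<in> S"
      using sym_Cay[OF S] h(2) by (auto dest: symD simp: parcs_Cay_iff)
    ultimately have "H #> (inv h \<otimes> x) \<subseteq> S"
      using coset by blast
    moreover have "(inv k \<otimes> h) \<otimes> (inv h \<otimes> x) \<in> H #> (inv h \<otimes> x)"
      using h k by (auto simp: r_coset_def)
    moreover have "(inv k \<otimes> h) \<otimes> (inv h \<otimes> x) = inv k \<otimes> x"
      using car by (simp add: m_assoc) (simp add: m_assoc[symmetric])
    ultimately have "(k, x) \<in> parcs (Cay G S)"
      using car by (auto simp: parcs_Cay_iff)
    then show ?thesis
      using sym_Cay[OF S] by (blast dest: symD)
  qed
  then have "homogeneous (Cay G S) H"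
    using H.subset H.one_closed unfolding homogeneous_def pverts_Cay by blast
  moreover have "2 \<le> card H"
  proof -
    obtain h where "h \<in> H" "h \<noteq> \<one>"
      using H(2) H.one_closed by blast
    then have "card {\<one>, h} \<le> card H"
      using fin H.subset by (intro card_mono) (auto intro: finite_subset)
    then show ?thesis
      using \<open>h \<noteq> \<one>\<close> by auto
  qed
  moreover have "card H < card (carrier G)"
    using fin H.subset H(3) by (intro psubset_card_mono) auto
  ultimately show ?thesis
    by (simp add: nontrivial_homogeneous_def)
qed

section \<open>Proper subgroups from connection sets that do not generate\<close>

lemma generate_neq_one:
  assumes "T \<subseteq> carrier G - {\<one>}" "T \<noteq> {}"
  shows "generate G T \<noteq> {\<one>}"
  using assms generate.incl[of _ T G] by blast

text \<open>A right coset of an element outside \<open>H\<close> misses \<open>H\<close>, while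
  every group element outside \<open>S\<close> lies in \<open>H\<close>.\<close>

lemma r_coset_subset_if_compl_subset:
  assumes S: "S \<subseteq> carrier G" and H: "subgroup H G" "carrier G - {\<one>} - S \<subseteq> H"
    and c: "c \<in> S - H"
  shows "H #> c \<subseteq> S"
proof
  interpret H: subgroup H G by fact
  fix z
  assume "z \<in> H #> c"
  then obtain h where h: "h \<in> H" "z = h \<otimes> c"
    by (auto simp: r_coset_def)
  have cG: "c \<in> carrier G" "c \<notin> H"
    using c S by auto
  have "z \<notin> H"
  proof
    assume "z \<in> H"
    then have "inv h \<otimes> z \<in> H"
      using h by blast
    then show False
      using h cG by (simp add: m_assoc[symmetric])
  qed
  moreover have "z \<in> carrier G"
    using h cG by simp
  ultimately show "z \<in> S"
    using H.one_closed H(2) by (metis DiffI singletonD subsetD)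
qed

end

text \<open>The second conjunct also asserts that a maximal \<open>H\<close> exists, so its
  universal claim is not vacuous.\<close>

theorem theorem3p4:
  fixes G :: "('a, 'b) monoid_scheme" (structure) and S :: "'a set"
  assumes "group G"
    and "finite (carrier G)"
    and "S \<subseteq> carrier G - {\<one>}"
    and "S = set_inv S"
    and "S \<noteq> carrier G - {\<one>}"
    and "S \<noteq> {}"
  shows "((\<exists>X. nontrivial_homogeneous (Cay G S) X) \<longleftrightarrow>
          (\<exists>H. subgroup H G \<and> H \<noteq> {\<one>} \<and> H \<noteq> carrier G \<and> (\<forall>c \<in> S - H. H #> c \<subseteq> S)))
       \<and> (connected_graph (Cay G S) \<and> anti_connected (Cay G S) \<and>
            (\<exists>X. nontrivial_homogeneous (Cay G S) X) \<longrightarrow>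
          (\<exists>H. maximal_homogeneous_at (Cay G S) \<one> H) \<and>
          (\<forall>H. maximal_homogeneous_at (Cay G S) \<one> H \<longrightarrow>
             subgroup H G \<and> (\<forall>c \<in> S - H. H #> c \<subseteq> S)))"
proof -
  interpret group G by fact
  let ?T = "carrier G - {\<one>} - S"
  let ?coset_closed = "\<lambda>H. \<forall>c \<in> S - H. H #> c \<subseteq> S"
  have S: "S \<subseteq> carrier G" "S = set_inv S"
    using assms by auto
  have T: "?T \<subseteq> carrier G" "?T \<subseteq> carrier G - {\<one>}" "?T \<noteq> {}"
    using assms by auto
  have maximal: "\<exists>H. maximal_homogeneous_at (Cay G S) \<one> H"
    if "nontrivial_homogeneous (Cay G S) X" for X
    using nontrivial_homogeneous_through_one[OF that] nontrivial_homogeneous_extend_maximal assms(2)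
    by (metis pverts_Cay)
  have good: "subgroup H G \<and> ?coset_closed H"
    if "generate G S = carrier G" "generate G ?T = carrier G"
      and H: "maximal_homogeneous_at (Cay G S) \<one> H" for H
  proof -
    have "subgroup H G"
      by (rule maximal_homogeneous_subgroup[OF assms(2) S that])
    moreover have "homogeneous (Cay G S) H"
      using H by (simp add: maximal_homogeneous_at_def nontrivial_homogeneous_def)
    ultimately show ?thesis
      using homogeneous_subgroup_r_coset_subset[OF S] by blast
  qed
  have coset_closed_subgroup:
    "\<exists>H. subgroup H G \<and> H \<noteq> {\<one>} \<and> H \<noteq> carrier G \<and> ?coset_closed H"
    if X: "nontrivial_homogeneous (Cay G S) X" for X
  proof -
    \<comment> \<open>Splitting on generation instead of connectedness means that only the
      implication from connected to generating is ever used.\<close>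
    consider "generate G S \<noteq> carrier G" | "generate G ?T \<noteq> carrier G"
      | "generate G S = carrier G" "generate G ?T = carrier G"
      by blast
    then show ?thesis
    proof cases
      case 1
      \<comment> \<open>The coset condition holds vacuously for this subgroup.\<close>
      have "S - generate G S = {}"
        using generate.incl by fastforce
      then show ?thesis
        using 1 generate_is_subgroup[OF S(1)] generate_neq_one[OF assms(3,6)] by blast
    next
      case 2
      have "?T \<subseteq> generate G ?T"
        by (meson generate.incl subsetI)
      then have "?coset_closed (generate G ?T)"
        using r_coset_subset_if_compl_subset[OF S(1) generate_is_subgroup[OF T(1)]] by blast
      then show ?thesis
        using 2 generate_is_subgroup[OF T(1)] generate_neq_one[OF T(2,3)] by blast
    next
      case 3
      obtain H where H: "maximal_homogeneous_at (Cay G S) \<one> H"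
        using maximal[OF X] by blast
      then have "H \<noteq> {\<one>}" "H \<noteq> carrier G"
        by (auto simp: maximal_homogeneous_at_def nontrivial_homogeneous_def)
      then show ?thesis
        using good[OF 3 H] by blast
    qed
  qed
  have subgroup_homogeneous: "\<exists>X. nontrivial_homogeneous (Cay G S) X"
    if "subgroup H G" "H \<noteq> {\<one>}" "H \<noteq> carrier G" "?coset_closed H" for H
    using subgroup_nontrivial_homogeneous[OF assms(2) S(2) that(1-3)] that(4) by blast
  have gen: "generate G S = carrier G" "generate G ?T = carrier G"
    if "connected_graph (Cay G S)" "anti_connected (Cay G S)"
    using that connected_Cay_imp_generate[OF S(1)] connected_Cay_imp_generate[OF T(1)]
    by (simp_all add: anti_connected_def graph_compl_Cay)
  show ?thesis
  proof (rule conjI, rule iffI)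
    show "\<exists>H. subgroup H G \<and> H \<noteq> {\<one>} \<and> H \<noteq> carrier G \<and> ?coset_closed H"
      if "\<exists>X. nontrivial_homogeneous (Cay G S) X"
      using that coset_closed_subgroup by (elim exE)
    show "\<exists>X. nontrivial_homogeneous (Cay G S) X"
      if "\<exists>H. subgroup H G \<and> H \<noteq> {\<one>} \<and> H \<noteq> carrier G \<and> ?coset_closed H"
      using that subgroup_homogeneous by (elim exE conjE)
  qed (use maximal good gen in \<open>(intro impI conjI allI; elim conjE exE)\<close>, simp_all)
qed

end
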